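(* Let $G=(V_G,E_G)$ be a simple graph with $V_G=\{1,\dots,n\}$ and $|E_G|\geq 2$, and let $\mathbb{K}$ be a field. If $G$ is a complete graph, then $\operatorname{d}(I(G))=2$.
   Context: $\mathbb{K}[E_G]=\mathbb{K}[t_e: e\in E_G]$ is the (standard graded) polynomial ring with one variable for each edge of $G$. Eulerian ideal: let $\varphi:\mathbb{K}[E_G]\to\mathbb{K}[x_1,\dots,x_n]$ be the $\mathbb{K}$-algebra homomorphism with $t_e\mapsto x_ix_j$ for every edge $e=\{i,j\}$. Then $I(G)=\varphi^{-1}\bigl((x_i^2-x_j^2 : i,j\in V_G)\bigr)$, a homogeneous ideal. $\operatorname{d}(I(G))$ denotes the maximal generating degree of $I(G)$, i.e. the maximum degree of an element of a minimal homogeneous generating set of $I(G)$. *)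

theory Defs
  imports "HOL-Library.Poly_Mapping" "HOL-Algebra.QuotRing"
begin

section \<open>Graphs\<close>

text \<open>An edge is a two-element set of vertices.\<close>

definition simple_graph :: "'v set \<Rightarrow> 'v set set \<Rightarrow> bool" where
  "simple_graph V E \<longleftrightarrow> finite V \<and> (\<forall>e\<in>E. e \<subseteq> V \<and> card e = 2)"

definition complete_graph :: "'v set \<Rightarrow> 'v set set \<Rightarrow> bool" where
  "complete_graph V E \<longleftrightarrow>
    simple_graph V E \<and> (\<forall>i\<in>V. \<forall>j\<in>V. i \<noteq> j \<longrightarrow> {i, j} \<in> E)"

section \<open>Polynomial rings\<close>

text \<open>
  A monomial is a finitely supported exponent function on the variables, and a polynomial is a
  finitely supported coefficient function on monomials; \<^theory>\<open>HOL-Library.Poly_Mapping\<close>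
  supplies the ring operations.
\<close>

type_synonym ('x, 'k) mpoly = "('x \<Rightarrow>\<^sub>0 nat) \<Rightarrow>\<^sub>0 'k"

definition mvar :: "'x \<Rightarrow> ('x, 'k::comm_ring_1) mpoly" where
  "mvar x = Poly_Mapping.single (Poly_Mapping.single x 1) 1"

definition mconst :: "'k::comm_ring_1 \<Rightarrow> ('x, 'k) mpoly" where
  "mconst c = Poly_Mapping.single 0 c"

text \<open>The polynomial ring in the variables \<open>X\<close>, with coefficients in the type \<open>'k\<close>.\<close>

definition mpoly_ring :: "'x set \<Rightarrow> ('x, 'k::comm_ring_1) mpoly ring" where
  "mpoly_ring X =
    \<lparr>carrier = {p. \<forall>m\<in>Poly_Mapping.keys p. Poly_Mapping.keys m \<subseteq> X},
     mult = (*), one = 1, zero = 0, add = (+)\<rparr>"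

text \<open>The homomorphism of algebras sending each variable \<open>x\<close> to \<open>f x\<close>.\<close>

definition mpoly_subst ::
    "('x \<Rightarrow> ('y, 'k::comm_ring_1) mpoly) \<Rightarrow> ('x, 'k) mpoly \<Rightarrow> ('y, 'k) mpoly" where
  "mpoly_subst f p =
    (\<Sum>m\<in>Poly_Mapping.keys p. mconst (Poly_Mapping.lookup p m) *
       (\<Prod>x\<in>Poly_Mapping.keys m. f x ^ Poly_Mapping.lookup m x))"

definition mono_deg :: "('x \<Rightarrow>\<^sub>0 nat) \<Rightarrow> nat" where
  "mono_deg m = (\<Sum>x\<in>Poly_Mapping.keys m. Poly_Mapping.lookup m x)"

text \<open>Total degree in the standard grading; the zero polynomial gets degree 0.\<close>

definition mpoly_deg :: "('x, 'k::zero) mpoly \<Rightarrow> nat" where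
  "mpoly_deg p = Max (insert 0 (mono_deg ` Poly_Mapping.keys p))"

definition homogeneous :: "('x, 'k::zero) mpoly \<Rightarrow> bool" where
  "homogeneous p \<longleftrightarrow> (\<exists>d. \<forall>m\<in>Poly_Mapping.keys p. mono_deg m = d)"

section \<open>Maximal generating degree\<close>

definition hom_gen_set ::
    "'x set \<Rightarrow> ('x, 'k::comm_ring_1) mpoly set \<Rightarrow> ('x, 'k) mpoly set \<Rightarrow> bool" where
  "hom_gen_set X I S \<longleftrightarrow>
    S \<subseteq> carrier (mpoly_ring X) \<and> (\<forall>f\<in>S. homogeneous f) \<and> genideal (mpoly_ring X) S = I"

definition min_hom_gen_set ::
    "'x set \<Rightarrow> ('x, 'k::comm_ring_1) mpoly set \<Rightarrow> ('x, 'k) mpoly set \<Rightarrow> bool" where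
  "min_hom_gen_set X I S \<longleftrightarrow>
    hom_gen_set X I S \<and> (\<forall>T. T \<subset> S \<longrightarrow> \<not> hom_gen_set X I T)"

text \<open>
  The definite description is meaningful for a nonzero homogeneous ideal over a field in finitely
  many variables: minimal homogeneous generating sets exist, they are finite and nonempty, and
  all of them have the same maximal degree.
\<close>

definition max_gen_degree :: "'x set \<Rightarrow> ('x, 'k::comm_ring_1) mpoly set \<Rightarrow> nat" where
  "max_gen_degree X I = (THE d. \<exists>S. min_hom_gen_set X I S \<and> d = Max (mpoly_deg ` S))"

section \<open>The Eulerian ideal\<close>

text \<open>For an edge \<open>e = {i, j}\<close> the product below is \<open>x\<^sub>i x\<^sub>j\<close>.\<close>

definition edge_hom :: "('v set, 'k::comm_ring_1) mpoly \<Rightarrow> ('v, 'k) mpoly" where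
  "edge_hom = mpoly_subst (\<lambda>e. \<Prod>i\<in>e. mvar i)"

definition square_diff_ideal :: "'v set \<Rightarrow> ('v, 'k::comm_ring_1) mpoly set" where
  "square_diff_ideal V =
    genideal (mpoly_ring V) {mvar i ^ 2 - mvar j ^ 2 | i j. i \<in> V \<and> j \<in> V}"

definition eulerian_ideal ::
    "'v set \<Rightarrow> 'v set set \<Rightarrow> ('v set, 'k::comm_ring_1) mpoly set" where
  "eulerian_ideal V E = {p \<in> carrier (mpoly_ring E). edge_hom p \<in> square_diff_ideal V}"

section \<open>Basic properties\<close>

lemma mpoly_ring_simps [simp]:
  "mult (mpoly_ring X) = (*)" "one (mpoly_ring X) = 1"
  "zero (mpoly_ring X) = 0" "add (mpoly_ring X) = (+)"
  by (simp_all add: mpoly_ring_def)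

lemma carrier_mpoly_ring:
  "p \<in> carrier (mpoly_ring X) \<longleftrightarrow> (\<forall>m\<in>Poly_Mapping.keys p. Poly_Mapping.keys m \<subseteq> X)"
  by (simp add: mpoly_ring_def)

lemma mpoly_ring_add_closed:
  "p \<in> carrier (mpoly_ring X) \<Longrightarrow> q \<in> carrier (mpoly_ring X) \<Longrightarrow> p + q \<in> carrier (mpoly_ring X)"
  unfolding carrier_mpoly_ring using Poly_Mapping.keys_add[of p q] by blast

lemma mpoly_ring_uminus_closed:
  "p \<in> carrier (mpoly_ring X) \<Longrightarrow> - p \<in> carrier (mpoly_ring X)"
  unfolding carrier_mpoly_ring by (simp add: in_keys_iff)

lemma mpoly_ring_mult_closed:
  fixes p q :: "('x, 'k::comm_ring_1) mpoly"
  assumes "p \<in> carrier (mpoly_ring X)" "q \<in> carrier (mpoly_ring X)"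
  shows "p * q \<in> carrier (mpoly_ring X)"
  unfolding carrier_mpoly_ring
proof
  fix m assume "m \<in> Poly_Mapping.keys (p * q)"
  then obtain a b where "m = a + b" "a \<in> Poly_Mapping.keys p" "b \<in> Poly_Mapping.keys q"
    using keys_mult[of p q] by blast
  moreover have "Poly_Mapping.keys (a + b) \<subseteq> Poly_Mapping.keys a \<union> Poly_Mapping.keys b"
    by (rule Poly_Mapping.keys_add)
  ultimately show "Poly_Mapping.keys m \<subseteq> X"
    using assms unfolding carrier_mpoly_ring by blast
qed

lemma mpoly_ring_zero_closed: "0 \<in> carrier (mpoly_ring X)"
  by (simp add: carrier_mpoly_ring)

lemma mpoly_ring_one_closed: "1 \<in> carrier (mpoly_ring X)"
  by (simp add: carrier_mpoly_ring)

lemma mconst_closed: "mconst c \<in> carrier (mpoly_ring X)"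
  by (auto simp: carrier_mpoly_ring mconst_def split: if_splits)

lemma mvar_closed: "x \<in> X \<Longrightarrow> mvar x \<in> carrier (mpoly_ring X)"
  by (auto simp: carrier_mpoly_ring mvar_def split: if_splits)

lemma mpoly_ring_power_closed:
  "p \<in> carrier (mpoly_ring X) \<Longrightarrow> p ^ k \<in> carrier (mpoly_ring X)"
  by (induction k) (auto intro: mpoly_ring_mult_closed mpoly_ring_one_closed)

lemma mpoly_ring_prod_closed:
  "(\<And>i. i \<in> A \<Longrightarrow> g i \<in> carrier (mpoly_ring X)) \<Longrightarrow> prod g A \<in> carrier (mpoly_ring X)"
  by (induction A rule: infinite_finite_induct)
    (auto intro: mpoly_ring_mult_closed mpoly_ring_one_closed)

lemma mpoly_ring_sum_closed:
  "(\<And>i. i \<in> A \<Longrightarrow> g i \<in> carrier (mpoly_ring X)) \<Longrightarrow> sum g A \<in> carrier (mpoly_ring X)"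
  by (induction A rule: infinite_finite_induct)
    (auto intro: mpoly_ring_add_closed mpoly_ring_zero_closed)

lemma cring_mpoly_ring: "cring (mpoly_ring X :: ('x, 'k::comm_ring_1) mpoly ring)"
proof (rule cringI)
  show "abelian_group (mpoly_ring X :: ('x, 'k) mpoly ring)"
  proof (rule abelian_groupI)
    fix p :: "('x, 'k) mpoly" assume "p \<in> carrier (mpoly_ring X)"
    then show "\<exists>q\<in>carrier (mpoly_ring X). q \<oplus>\<^bsub>mpoly_ring X\<^esub> p = \<zero>\<^bsub>mpoly_ring X\<^esub>"
      by (intro bexI[of _ "- p"]) (auto intro: mpoly_ring_uminus_closed)
  qed (auto intro: mpoly_ring_add_closed mpoly_ring_zero_closed simp: algebra_simps)
  show "comm_monoid (mpoly_ring X :: ('x, 'k) mpoly ring)"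
    by (rule comm_monoidI)
      (auto intro: mpoly_ring_mult_closed mpoly_ring_one_closed simp: algebra_simps)
qed (simp add: algebra_simps)

lemma mpoly_induct [case_names single add]:
  fixes p :: "'a \<Rightarrow>\<^sub>0 'b::comm_monoid_add"
  assumes "\<And>m c. P (Poly_Mapping.single m c)" and "\<And>p q. P p \<Longrightarrow> P q \<Longrightarrow> P (p + q)"
  shows "P p"
proof -
  have eq: "p = (\<Sum>m\<in>Poly_Mapping.keys p. Poly_Mapping.single m (Poly_Mapping.lookup p m))"
    by (rule poly_mapping_eqI)
      (auto simp: lookup_sum lookup_single when_def in_keys_iff sum.delta)
  have "P (\<Sum>m\<in>A. Poly_Mapping.single m (Poly_Mapping.lookup p m))" if "finite A" for A
    using that
  proof induction
    case empty
    show ?case using assms(1)[of undefined 0] by simp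
  qed (simp add: assms)
  then show ?thesis using eq by (metis finite_keys)
qed

lemma mpoly_subst_single:
  "mpoly_subst f (Poly_Mapping.single m c) =
    mconst c * (\<Prod>x\<in>Poly_Mapping.keys m. f x ^ Poly_Mapping.lookup m x)"
  by (simp add: mpoly_subst_def mconst_def)

lemma mpoly_subst_mconst: "mpoly_subst f (mconst c) = mconst c"
  by (simp add: mconst_def mpoly_subst_single)

lemma mpoly_subst_mvar: "mpoly_subst f (mvar x) = f x"
  by (simp add: mvar_def mpoly_subst_single) (simp add: mconst_def)

lemma mpoly_subst_one: "mpoly_subst f 1 = 1"
  using mpoly_subst_mconst[of f 1] by (simp add: mconst_def)

lemma mpoly_subst_add: "mpoly_subst f (p + q) = mpoly_subst f p + mpoly_subst f q"
  unfolding mpoly_subst_def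
  by (rule setsum_keys_plus_distrib) (simp_all add: mconst_def single_add algebra_simps)

lemma prod_pow_add:
  fixes f :: "'x \<Rightarrow> 'r::comm_monoid_mult" and a b :: "'x \<Rightarrow>\<^sub>0 nat"
  shows "(\<Prod>x\<in>Poly_Mapping.keys (a + b). f x ^ Poly_Mapping.lookup (a + b) x) =
    (\<Prod>x\<in>Poly_Mapping.keys a. f x ^ Poly_Mapping.lookup a x) *
    (\<Prod>x\<in>Poly_Mapping.keys b. f x ^ Poly_Mapping.lookup b x)"
proof -
  let ?A = "Poly_Mapping.keys a \<union> Poly_Mapping.keys b"
  have ext: "(\<Prod>x\<in>Poly_Mapping.keys m. f x ^ Poly_Mapping.lookup m x) =
      (\<Prod>x\<in>?A. f x ^ Poly_Mapping.lookup m x)"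
    if "Poly_Mapping.keys m \<subseteq> ?A" for m :: "'x \<Rightarrow>\<^sub>0 nat"
    using that by (intro prod.mono_neutral_left) (auto simp: in_keys_iff)
  have "(\<Prod>x\<in>Poly_Mapping.keys (a + b). f x ^ Poly_Mapping.lookup (a + b) x) =
      (\<Prod>x\<in>?A. f x ^ Poly_Mapping.lookup (a + b) x)"
    by (rule ext) (rule Poly_Mapping.keys_add)
  then show ?thesis
    using ext[of a] ext[of b] by (simp add: lookup_add power_add prod.distrib)
qed

lemma mpoly_subst_mult:
  fixes f :: "'x \<Rightarrow> ('y, 'k::comm_ring_1) mpoly"
  shows "mpoly_subst f (p * q) = mpoly_subst f p * mpoly_subst f q"
proof (induction p rule: mpoly_induct)
  case (single a c)
  show ?case
  proof (induction q rule: mpoly_induct)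
    case (single b d)
    have "mconst (c * d) = mconst c * (mconst d :: ('y, 'k) mpoly)"
      by (simp add: mconst_def mult_single)
    then show ?case
      by (simp add: mult_single mpoly_subst_single prod_pow_add algebra_simps)
  qed (simp add: mpoly_subst_add algebra_simps)
qed (simp add: mpoly_subst_add algebra_simps)

lemma mpoly_subst_closed:
  assumes "\<And>x. x \<in> X \<Longrightarrow> f x \<in> carrier (mpoly_ring Y)" "p \<in> carrier (mpoly_ring X)"
  shows "mpoly_subst f p \<in> carrier (mpoly_ring Y)"
  unfolding mpoly_subst_def
  using assms(2) unfolding carrier_mpoly_ring[of p]
  by (intro mpoly_ring_sum_closed mpoly_ring_mult_closed mconst_closed mpoly_ring_prod_closed
      mpoly_ring_power_closed assms(1)) auto

lemma mpoly_subst_hom: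
  assumes "\<And>x. x \<in> X \<Longrightarrow> f x \<in> carrier (mpoly_ring Y)"
  shows "mpoly_subst f \<in> ring_hom (mpoly_ring X) (mpoly_ring Y)"
  by (rule ring_hom_memI)
    (auto intro: mpoly_subst_closed assms simp: mpoly_subst_add mpoly_subst_mult mpoly_subst_one)

lemma edge_hom_mvar: "i \<noteq> j \<Longrightarrow> edge_hom (mvar {i, j}) = mvar i * mvar j"
  by (simp add: edge_hom_def mpoly_subst_mvar)

lemma edge_hom_ring_hom:
  assumes "simple_graph V E"
  shows "edge_hom \<in> ring_hom (mpoly_ring E) (mpoly_ring V)"
  unfolding edge_hom_def
  using assms unfolding simple_graph_def
  by (intro mpoly_subst_hom mpoly_ring_prod_closed mvar_closed) auto

lemma eulerian_ideal_ideal: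
  assumes "simple_graph V E"
  shows "ideal (eulerian_ideal V E :: ('v set, 'k::comm_ring_1) mpoly set) (mpoly_ring E)"
proof -
  interpret V: cring "mpoly_ring V :: ('v, 'k) mpoly ring" by (rule cring_mpoly_ring)
  interpret h: ring_hom_ring "mpoly_ring E :: ('v set, 'k) mpoly ring" "mpoly_ring V" edge_hom
    by (intro ring_hom_ringI2 edge_hom_ring_hom assms cring.axioms(1) cring_mpoly_ring)
  have diff: "p - q \<in> carrier (mpoly_ring V)"
    if "p \<in> carrier (mpoly_ring V)" "q \<in> carrier (mpoly_ring V)" for p q :: "('v, 'k) mpoly"
    using mpoly_ring_add_closed[OF that(1) mpoly_ring_uminus_closed[OF that(2)]] by simp
  have "{mvar i ^ 2 - mvar j ^ 2 | i j. i \<in> V \<and> j \<in> V} \<subseteq>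
      carrier (mpoly_ring V :: ('v, 'k) mpoly ring)"
    by (auto intro!: diff mpoly_ring_power_closed mvar_closed)
  then have "ideal (square_diff_ideal V) (mpoly_ring V :: ('v, 'k) mpoly ring)"
    unfolding square_diff_ideal_def by (rule V.genideal_ideal)
  from h.ideal_vimage[OF this] show ?thesis
    by (simp add: eulerian_ideal_def)
qed

end

theory Submission
  imports Defs
begin

text \<open>
  Modulo the differences \<open>x\<^sub>i\<^sup>2 - x\<^sub>j\<^sup>2\<close> a monomial is determined by its degree and the parities of its
  exponents, and no linear relation holds between monomials that differ in these data. A monomial in
  the edge variables is a multigraph, whose image has the vertex degrees as exponents. So the
  Eulerian ideal is spanned by the differences of multigraphs with equally many edges and the same
  vertices of odd degree (\<open>pairing_square_diff_ideal\<close>, \<open>cancelling_term\<close>).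

  In a complete graph two such multigraphs are connected by exchanges of two edges against two
  edges: a path \<open>a b c\<close> may be replaced by \<open>a x c\<close>, and edges \<open>ab\<close>, \<open>cd\<close> by \<open>ac\<close>, \<open>bd\<close>. This is the
  combinatorial core, \<open>swap_eq_if_same_invariants\<close>. It goes by induction on the number of edges:
  exchanges produce an edge common to both multigraphs (\<open>common_edge\<close>), which is then removed. All
  the edges that the exchanges call for are available because the graph is complete. Each exchange
  is a quadratic binomial of the ideal, hence the ideal is generated by quadrics.

  An ideal generated by finitely many forms of degree \<open>d\<close> and different from zero has maximal
  generating degree \<open>d\<close>, since every homogeneous generating set can be cut down to its members of
  degree \<open>d\<close> (\<open>max_gen_degree_eqI\<close>).
\<close>

section \<open>Monomials and ideals of polynomial rings\<close>

definition unit_exp :: "'x \<Rightarrow> 'x \<Rightarrow>\<^sub>0 nat" where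
  "unit_exp x = Poly_Mapping.single x 1"

lemma lookup_unit_exp: "Poly_Mapping.lookup (unit_exp x) y = (if y = x then 1 else 0)"
  by (simp add: unit_exp_def lookup_single when_def)

lemma keys_unit_exp [simp]: "Poly_Mapping.keys (unit_exp x) = {x}"
  by (simp add: unit_exp_def)

lemma mvar_eq_single: "mvar x = Poly_Mapping.single (unit_exp x) 1"
  by (simp add: mvar_def unit_exp_def)

lemma keys_add_nat:
  "Poly_Mapping.keys (a + b :: 'x \<Rightarrow>\<^sub>0 nat) = Poly_Mapping.keys a \<union> Poly_Mapping.keys b"
  by (auto simp: in_keys_iff lookup_add)

lemma split_off_unit_exp:
  assumes "x \<in> Poly_Mapping.keys m"
  obtains k where "m = unit_exp x + k"
proof
  show "m = unit_exp x + (m - unit_exp x)"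
    using assms
    by (intro poly_mapping_eqI) (auto simp: in_keys_iff lookup_add lookup_minus lookup_unit_exp)
qed

lemma mono_deg_add: "mono_deg (a + b) = mono_deg a + mono_deg b"
  unfolding mono_deg_def by (rule setsum_keys_plus_distrib) simp_all

lemma mono_deg_single [simp]: "mono_deg (Poly_Mapping.single x k) = k"
  by (simp add: mono_deg_def)

lemma mono_deg_unit_exp [simp]: "mono_deg (unit_exp x) = 1"
  by (simp add: unit_exp_def)

lemma mono_deg_0 [simp]: "mono_deg 0 = 0"
  by (simp add: mono_deg_def)

lemma mono_deg_eq_0_iff [simp]: "mono_deg m = 0 \<longleftrightarrow> m = 0"
  by (auto simp: mono_deg_def in_keys_iff intro!: poly_mapping_eqI)

lemma mpoly_deg_homogeneous:
  assumes "f \<noteq> 0" "\<And>m. m \<in> Poly_Mapping.keys f \<Longrightarrow> mono_deg m = d"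
  shows "mpoly_deg f = d"
proof -
  have "mono_deg ` Poly_Mapping.keys f = {d}"
    using assms by (auto simp flip: keys_eq_empty)
  then show ?thesis by (simp add: mpoly_deg_def)
qed

lemma mpoly_eq_sum_monomials:
  "p = (\<Sum>m\<in>Poly_Mapping.keys p. Poly_Mapping.single m (Poly_Mapping.lookup p m))"
  by (rule poly_mapping_eqI)
    (auto simp: lookup_sum lookup_single when_def in_keys_iff sum.delta)

lemma mpoly_ideal_zero: "ideal J (mpoly_ring X) \<Longrightarrow> 0 \<in> J"
  using additive_subgroup.zero_closed[OF ideal.axioms(1)] by fastforce

lemma mpoly_ideal_add: "ideal J (mpoly_ring X) \<Longrightarrow> p \<in> J \<Longrightarrow> q \<in> J \<Longrightarrow> p + q \<in> J"
  using additive_subgroup.a_closed[OF ideal.axioms(1)] by fastforce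

lemma mpoly_ideal_mult:
  "ideal J (mpoly_ring X) \<Longrightarrow> p \<in> J \<Longrightarrow> r \<in> carrier (mpoly_ring X) \<Longrightarrow> r * p \<in> J"
  using ideal.I_l_closed[of J "mpoly_ring X" p r] by simp

lemma mpoly_ideal_carrier: "ideal J (mpoly_ring X) \<Longrightarrow> J \<subseteq> carrier (mpoly_ring X)"
  using additive_subgroup.a_subset[OF ideal.axioms(1)] .

lemma mpoly_ideal_uminus:
  assumes "ideal J (mpoly_ring X)" "p \<in> J"
  shows "- p \<in> J"
proof -
  have "- 1 \<in> carrier (mpoly_ring X)"
    by (intro mpoly_ring_uminus_closed mpoly_ring_one_closed)
  then have "- 1 * p \<in> J" by (rule mpoly_ideal_mult[OF assms])
  then show ?thesis by simp
qed

lemma mpoly_ideal_diff: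
  "ideal J (mpoly_ring X) \<Longrightarrow> p \<in> J \<Longrightarrow> q \<in> J \<Longrightarrow> p - q \<in> J"
  using mpoly_ideal_add[of J X p "- q"] mpoly_ideal_uminus[of J X q] by simp

lemma mpoly_ring_diff_closed:
  "p \<in> carrier (mpoly_ring X) \<Longrightarrow> q \<in> carrier (mpoly_ring X) \<Longrightarrow>
    p - q \<in> carrier (mpoly_ring X)"
  using mpoly_ring_add_closed[OF _ mpoly_ring_uminus_closed, of p X q] by simp

lemma single_closed:
  "Poly_Mapping.keys m \<subseteq> X \<Longrightarrow> Poly_Mapping.single m c \<in> carrier (mpoly_ring X)"
  by (simp add: carrier_mpoly_ring)

text \<open>
  Since every polynomial is a sum of terms, absorption need only be tested on terms.
\<close>

lemma mpoly_idealI: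
  fixes J :: "('x, 'k::comm_ring_1) mpoly set"
  assumes sub: "J \<subseteq> carrier (mpoly_ring X)"
    and zero: "0 \<in> J"
    and add: "\<And>p q. p \<in> J \<Longrightarrow> q \<in> J \<Longrightarrow> p + q \<in> J"
    and mult: "\<And>p a c. p \<in> J \<Longrightarrow> Poly_Mapping.keys a \<subseteq> X \<Longrightarrow> Poly_Mapping.single a c * p \<in> J"
  shows "ideal J (mpoly_ring X)"
proof -
  interpret cring "mpoly_ring X :: ('x, 'k) mpoly ring" by (rule cring_mpoly_ring)
  have l: "r * p \<in> J" if p: "p \<in> J" and r: "r \<in> carrier (mpoly_ring X)" for p r
  proof -
    have "(\<Sum>m\<in>A. Poly_Mapping.single m (Poly_Mapping.lookup r m) * p) \<in> J"
      if "A \<subseteq> Poly_Mapping.keys r" for A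
      using finite_subset[OF that finite_keys] that
    proof (induction A rule: finite_induct)
      case (insert m A)
      then have "Poly_Mapping.keys m \<subseteq> X" using r by (auto simp: carrier_mpoly_ring)
      then show ?case using insert p by (simp add: add mult)
    qed (simp add: zero)
    from this[OF subset_refl] show ?thesis
      by (subst mpoly_eq_sum_monomials[of r]) (simp add: sum_distrib_right)
  qed
  have neg: "- p \<in> J" if "p \<in> J" for p
    using l[OF that mpoly_ring_uminus_closed[OF mpoly_ring_one_closed]] by simp
  show ?thesis
  proof (rule idealI)
    show "subgroup J (add_monoid (mpoly_ring X))"
    proof (rule add.subgroupI)
      fix p assume p: "p \<in> J"
      have "\<ominus>\<^bsub>mpoly_ring X\<^esub> p = - p"
        using p sub by (intro minus_equality) (auto intro: mpoly_ring_uminus_closed)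
      then show "\<ominus>\<^bsub>mpoly_ring X\<^esub> p \<in> J" using neg[OF p] by simp
    qed (use sub zero add in auto)
  qed (use l in \<open>auto simp: mult.commute ring_axioms\<close>)
qed

lemma genideal_mpoly_ideal:
  fixes S :: "('x, 'k::comm_ring_1) mpoly set"
  assumes "S \<subseteq> carrier (mpoly_ring X)"
  shows "ideal (genideal (mpoly_ring X) S) (mpoly_ring X)"
  using ring.genideal_ideal[OF cring.axioms(1)[OF cring_mpoly_ring] assms] .

lemma genideal_mpoly_least:
  fixes J :: "('x, 'k::comm_ring_1) mpoly set"
  assumes "ideal J (mpoly_ring X)" "S \<subseteq> J"
  shows "genideal (mpoly_ring X) S \<subseteq> J"
  using ring.genideal_minimal[OF cring.axioms(1)[OF cring_mpoly_ring] assms] .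

lemma genideal_mpoly_superset:
  fixes S :: "('x, 'k::comm_ring_1) mpoly set"
  assumes "S \<subseteq> carrier (mpoly_ring X)"
  shows "S \<subseteq> genideal (mpoly_ring X) S"
  using ring.genideal_self[OF cring.axioms(1)[OF cring_mpoly_ring] assms] .

section \<open>Ideals generated in a single degree\<close>

text \<open>
  Multiplication by a term cannot lower degrees. An ideal generated in degree \<open>d\<close> therefore has
  nothing below degree \<open>d\<close>.
\<close>

lemma terms_of_degree_ge_ideal:
  "ideal {p \<in> carrier (mpoly_ring X). \<forall>m\<in>Poly_Mapping.keys p. d \<le> mono_deg m}
    (mpoly_ring X :: ('x, 'k::comm_ring_1) mpoly ring)"
proof (rule mpoly_idealI)
  fix p :: "('x, 'k) mpoly" and a :: "'x \<Rightarrow>\<^sub>0 nat" and c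
  assume p: "p \<in> {p \<in> carrier (mpoly_ring X). \<forall>m\<in>Poly_Mapping.keys p. d \<le> mono_deg m}"
    and a: "Poly_Mapping.keys a \<subseteq> X"
  have "d \<le> mono_deg m" if m: "m \<in> Poly_Mapping.keys (Poly_Mapping.single a c * p)" for m
  proof -
    obtain k where "m = a + k" "k \<in> Poly_Mapping.keys p"
      using keys_mult[of "Poly_Mapping.single a c" p] m by (auto split: if_splits)
    then show ?thesis using p by (auto simp: mono_deg_add intro: trans_le_add2)
  qed
  then show "Poly_Mapping.single a c * p
      \<in> {p \<in> carrier (mpoly_ring X). \<forall>m\<in>Poly_Mapping.keys p. d \<le> mono_deg m}"
    using p by (auto intro!: mpoly_ring_mult_closed single_closed a)
next
  fix p q :: "('x, 'k) mpoly"
  assume "p \<in> {p \<in> carrier (mpoly_ring X). \<forall>m\<in>Poly_Mapping.keys p. d \<le> mono_deg m}"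
    "q \<in> {p \<in> carrier (mpoly_ring X). \<forall>m\<in>Poly_Mapping.keys p. d \<le> mono_deg m}"
  then show "p + q \<in> {p \<in> carrier (mpoly_ring X). \<forall>m\<in>Poly_Mapping.keys p. d \<le> mono_deg m}"
    using Poly_Mapping.keys_add[of p q] by (auto intro: mpoly_ring_add_closed)
qed (auto intro: mpoly_ring_zero_closed)

lemma lookup_single_0_mult:
  fixes p :: "('x, 'k::comm_ring_1) mpoly"
  shows "Poly_Mapping.lookup (Poly_Mapping.single 0 c * p) m = c * Poly_Mapping.lookup p m"
proof (induction p rule: mpoly_induct)
  case (single a d)
  then show ?case by (simp add: mult_single lookup_single when_def)
qed (simp add: distrib_left lookup_add)

text \<open>
  Let \<open>I\<close> be generated by forms of degree \<open>d\<close>. Multiplying an element of \<open>I\<close> by a nonconstant term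
  moves it into degrees above \<open>d\<close>, so the degree \<open>d\<close> part of a combination of elements of \<open>S\<close> is
  already a combination, with constant coefficients, of the degree \<open>d\<close> members of \<open>S\<close>. Hence those
  members generate all the given degree \<open>d\<close> generators, and with them \<open>I\<close>.
\<close>

lemma hom_gen_set_lowest_degree:
  fixes I S :: "('x, 'k::comm_ring_1) mpoly set"
  assumes B: "B \<subseteq> carrier (mpoly_ring X)" "genideal (mpoly_ring X) B = I"
    and Bdeg: "\<And>b m. b \<in> B \<Longrightarrow> m \<in> Poly_Mapping.keys b \<Longrightarrow> mono_deg m = d"
    and S: "hom_gen_set X I S"
  shows "hom_gen_set X I {f \<in> S. f \<noteq> 0 \<and> (\<forall>m\<in>Poly_Mapping.keys f. mono_deg m = d)}"
    (is "hom_gen_set X I ?T")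
proof -
  let ?R = "mpoly_ring X :: ('x, 'k) mpoly ring"
  let ?J = "genideal ?R ?T"
  have Sc: "S \<subseteq> carrier ?R" and Sg: "genideal ?R S = I" and Sh: "\<And>f. f \<in> S \<Longrightarrow> homogeneous f"
    using S by (auto simp: hom_gen_set_def)
  have Tc: "?T \<subseteq> carrier ?R" using Sc by auto
  have J: "ideal ?J ?R" by (rule genideal_mpoly_ideal[OF Tc])
  have I: "ideal I ?R" using genideal_mpoly_ideal[OF Sc] Sg by simp
  have SI: "S \<subseteq> I" using genideal_mpoly_superset[OF Sc] Sg by simp
  define ge where "ge p \<longleftrightarrow> p \<in> carrier ?R \<and> (\<forall>m\<in>Poly_Mapping.keys p. d \<le> mono_deg m)"
    for p :: "('x, 'k) mpoly"
  have geI: "ideal (Collect ge) ?R"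
    using terms_of_degree_ge_ideal[of X d] by (simp add: ge_def[abs_def])
  have "B \<subseteq> Collect ge" using B(1) Bdeg by (auto simp: ge_def)
  from genideal_mpoly_least[OF geI this] have I_ge: "I \<subseteq> Collect ge" unfolding B(2) .
  define part where
    "part p q \<longleftrightarrow> (\<forall>m. Poly_Mapping.lookup q m = (if mono_deg m = d then Poly_Mapping.lookup p m else 0))"
    for p q :: "('x, 'k) mpoly"
  \<comment> \<open>The bound \<open>ge\<close> has to be carried along: it is what makes the degree \<open>d\<close> part vanish after
    multiplication by a nonconstant term, and so makes \<open>Q\<close> an ideal.\<close>
  define Q where "Q = {p. ge p \<and> (\<exists>q\<in>?J. part p q)}"
  have "ideal Q ?R"
  proof (rule mpoly_idealI)
    show "Q \<subseteq> carrier ?R" by (auto simp: Q_def ge_def)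
    have "part 0 0" by (simp add: part_def)
    then show "0 \<in> Q"
      using mpoly_ideal_zero[OF geI] mpoly_ideal_zero[OF J] by (auto simp: Q_def)
  next
    fix p q assume "p \<in> Q" "q \<in> Q"
    then obtain p' q' where *: "ge p" "ge q" "p' \<in> ?J" "q' \<in> ?J" "part p p'" "part q q'"
      by (auto simp: Q_def)
    then have "ge (p + q)" using mpoly_ideal_add[OF geI] by auto
    moreover have "part (p + q) (p' + q')" using * by (simp add: part_def lookup_add)
    ultimately show "p + q \<in> Q" using mpoly_ideal_add[OF J] * by (auto simp: Q_def)
  next
    fix p and a :: "'x \<Rightarrow>\<^sub>0 nat" and c :: 'k
    assume p: "p \<in> Q" and a: "Poly_Mapping.keys a \<subseteq> X"
    then obtain p' where *: "ge p" "p' \<in> ?J" "part p p'" by (auto simp: Q_def)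
    have ge': "ge (Poly_Mapping.single a c * p)"
      using mpoly_ideal_mult[OF geI _ single_closed[OF a]] * by auto
    show "Poly_Mapping.single a c * p \<in> Q"
    proof (cases "a = 0")
      case True
      then have "part (Poly_Mapping.single a c * p) (Poly_Mapping.single a c * p')"
        using * by (simp add: part_def lookup_single_0_mult)
      then show ?thesis
        using ge' mpoly_ideal_mult[OF J *(2) single_closed[OF a]] by (auto simp: Q_def)
    next
      case False
      have "mono_deg m \<noteq> d" if m: "m \<in> Poly_Mapping.keys (Poly_Mapping.single a c * p)" for m
      proof -
        obtain k where "m = a + k" "k \<in> Poly_Mapping.keys p"
          using keys_mult[of "Poly_Mapping.single a c" p] m by (auto split: if_splits)
        then show ?thesis using *(1) False mono_deg_eq_0_iff[of a] 
          by (auto simp: mono_deg_add ge_def simp del: mono_deg_eq_0_iff dest!: bspec)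
      qed
      then have "part (Poly_Mapping.single a c * p) 0" by (auto simp: part_def in_keys_iff)
      then show ?thesis using ge' mpoly_ideal_zero[OF J] by (auto simp: Q_def)
    qed
  qed
  moreover have "S \<subseteq> Q"
  proof
    fix f assume f: "f \<in> S"
    then have gef: "ge f" using SI I_ge by auto
    obtain e where e: "\<And>m. m \<in> Poly_Mapping.keys f \<Longrightarrow> mono_deg m = e"
      using Sh[OF f] by (auto simp: homogeneous_def)
    show "f \<in> Q"
    proof (cases "f \<noteq> 0 \<and> e = d")
      case True
      then have "f \<in> ?J" using genideal_mpoly_superset[OF Tc] f e by auto
      moreover have "part f f" using e True by (auto simp: part_def in_keys_iff)
      ultimately show ?thesis using gef by (auto simp: Q_def)
    next
      case False
      then have "part f 0" using e by (auto simp: part_def in_keys_iff)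
      then show ?thesis using gef mpoly_ideal_zero[OF J] by (auto simp: Q_def)
    qed
  qed
  ultimately have "I \<subseteq> Q" using genideal_mpoly_least[of Q X S] Sg by auto
  have "B \<subseteq> ?J"
  proof
    fix b assume b: "b \<in> B"
    then have "b \<in> Q" using \<open>I \<subseteq> Q\<close> genideal_mpoly_superset[OF B(1)] B(2) by auto
    then obtain q where q: "q \<in> ?J" "part b q" by (auto simp: Q_def)
    have "q = b"
      using q(2) Bdeg[OF b] by (intro poly_mapping_eqI) (auto simp: part_def in_keys_iff)
    then show "b \<in> ?J" using q by simp
  qed
  then have "I \<subseteq> ?J" using genideal_mpoly_least[OF J] B(2) by auto
  moreover have "?J \<subseteq> I" using SI by (intro genideal_mpoly_least[OF I]) auto
  ultimately show ?thesis using Tc Sh by (auto simp: hom_gen_set_def)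
qed

text \<open>
  By the previous lemma a minimal homogeneous generating set lies entirely in degree \<open>d\<close>, and it is
  nonempty because \<open>I\<close> is nonzero; so every one of them yields the value \<open>d\<close>. That there is at
  least one follows by choosing a smallest generating subset of the finite set \<open>B\<close>.
\<close>

lemma max_gen_degree_eqI:
  fixes I :: "('x, 'k::comm_ring_1) mpoly set"
  assumes fin: "finite B"
    and B: "B \<subseteq> carrier (mpoly_ring X)" "genideal (mpoly_ring X) B = I"
    and Bdeg: "\<And>b m. b \<in> B \<Longrightarrow> m \<in> Poly_Mapping.keys b \<Longrightarrow> mono_deg m = d"
    and nz: "I \<noteq> {0}"
  shows "max_gen_degree X I = d"
proof -
  have deg: "Max (mpoly_deg ` S) = d" if S: "min_hom_gen_set X I S" for S
  proof -
    let ?T = "{f \<in> S. f \<noteq> 0 \<and> (\<forall>m\<in>Poly_Mapping.keys f. mono_deg m = d)}"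
    have "hom_gen_set X I ?T"
      using hom_gen_set_lowest_degree[OF B Bdeg] S by (auto simp: min_hom_gen_set_def)
    then have T: "?T = S"
      using S unfolding min_hom_gen_set_def by (metis (no_types, lifting) mem_Collect_eq psubsetI subsetI)
    have "S \<noteq> {}"
    proof
      assume "S = {}"
      then have I: "I = genideal (mpoly_ring X) {}"
        using S by (auto simp: min_hom_gen_set_def hom_gen_set_def)
      have "ideal {0} (mpoly_ring X :: ('x, 'k) mpoly ring)"
        by (rule mpoly_idealI) (auto intro: mpoly_ring_zero_closed)
      then have "I \<subseteq> {0}" unfolding I by (rule genideal_mpoly_least) simp
      moreover have "0 \<in> I" unfolding I by (rule mpoly_ideal_zero[OF genideal_mpoly_ideal]) simp
      ultimately show False using nz by auto
    qed
    moreover have "mpoly_deg f = d" if "f \<in> S" for f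
      using that T by (intro mpoly_deg_homogeneous) auto
    ultimately have "mpoly_deg ` S = {d}" by auto
    then show ?thesis by simp
  qed
  define P where "P S \<longleftrightarrow> S \<subseteq> B \<and> hom_gen_set X I S" for S
  have "P B" using B Bdeg by (auto simp: P_def hom_gen_set_def homogeneous_def)
  then obtain S where S: "P S" "\<And>T. P T \<Longrightarrow> card S \<le> card T"
    using ex_has_least_nat[of P B card] by auto
  have "min_hom_gen_set X I S"
    unfolding min_hom_gen_set_def
  proof (intro conjI allI impI notI)
    show "hom_gen_set X I S" using S by (simp add: P_def)
    fix T assume T: "T \<subset> S" "hom_gen_set X I T"
    then have "card S \<le> card T" using S by (auto simp: P_def)
    moreover have "card T < card S"
      using T S fin by (intro psubset_card_mono) (auto simp: P_def intro: finite_subset)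
    ultimately show False by simp
  qed
  then show ?thesis
    unfolding max_gen_degree_def using deg by (intro the_equality) auto
qed

section \<open>Exchanging edges in multigraphs\<close>

text \<open>
  An exponent vector \<open>m\<close> on the edges is a multigraph, with edge multiplicities as exponents. Its
  \<open>incidence\<close> is the degree sequence of that multigraph, which is also the exponent of the image of
  the monomial \<open>m\<close> under \<^const>\<open>edge_hom\<close>.
\<close>

definition incidence :: "('v set \<Rightarrow>\<^sub>0 nat) \<Rightarrow> 'v \<Rightarrow>\<^sub>0 nat" where
  "incidence m = (\<Sum>e\<in>Poly_Mapping.keys m. \<Sum>v\<in>e. Poly_Mapping.single v (Poly_Mapping.lookup m e))"

lemma incidence_add: "incidence (m + k) = incidence m + incidence k"
  unfolding incidence_def
  by (rule setsum_keys_plus_distrib) (simp_all add: single_add sum.distrib)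

definition vdeg :: "('v set \<Rightarrow>\<^sub>0 nat) \<Rightarrow> 'v \<Rightarrow> nat" where
  "vdeg m v = Poly_Mapping.lookup (incidence m) v"

lemma vdeg_add: "vdeg (m + k) v = vdeg m v + vdeg k v"
  by (simp add: vdeg_def incidence_add lookup_add)

definition edge :: "'v \<Rightarrow> 'v \<Rightarrow> 'v set \<Rightarrow>\<^sub>0 nat" where
  "edge a b = unit_exp {a, b}"

lemma edge_commute: "edge a b = edge b a"
  by (simp add: edge_def insert_commute)

lemma keys_edge [simp]: "Poly_Mapping.keys (edge a b) = {{a, b}}"
  by (simp add: edge_def)

lemma mono_deg_edge [simp]: "mono_deg (edge a b) = 1"
  by (simp add: edge_def)

lemma incidence_edge: "a \<noteq> b \<Longrightarrow> incidence (edge a b) = unit_exp a + unit_exp b"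
  by (simp add: incidence_def edge_def unit_exp_def)

lemma vdeg_edge:
  "a \<noteq> b \<Longrightarrow> vdeg (edge a b) v = (if v = a then 1 else 0) + (if v = b then 1 else 0)"
  by (simp add: vdeg_def incidence_edge lookup_add lookup_unit_exp)

lemma vdeg_uncovered: "(\<And>e. e \<in> Poly_Mapping.keys m \<Longrightarrow> v \<notin> e) \<Longrightarrow> vdeg m v = 0"
  unfolding vdeg_def incidence_def lookup_sum lookup_single when_def
  by (intro sum.neutral ballI) auto

lemma odd_vdeg_covered: "odd (vdeg m v) \<Longrightarrow> \<exists>e\<in>Poly_Mapping.keys m. v \<in> e"
  by (metis even_zero vdeg_uncovered)

text \<open>
  The equivalence of multigraphs generated by exchanging two edges at a time in two ways: \<open>pivot\<close>
  replaces the middle vertex of a path of length two (the path may go back and forth, \<open>a = c\<close>, in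
  which case a doubled edge is moved), and \<open>cross\<close> reconnects the four ends of two edges. These two
  moves are the quadratic binomials that will generate the ideal. In the rule \<open>add\<close> the multiplier
  \<open>l\<close> is restricted to honest edges on \<open>V\<close>, so that it is a monomial of the ring in question.
\<close>

inductive swap_eq :: "'v set \<Rightarrow> ('v set \<Rightarrow>\<^sub>0 nat) \<Rightarrow> ('v set \<Rightarrow>\<^sub>0 nat) \<Rightarrow> bool"
  for V :: "'v set" where
  refl: "swap_eq V m m"
| sym: "swap_eq V m k \<Longrightarrow> swap_eq V k m"
| trans: "swap_eq V m k \<Longrightarrow> swap_eq V k l \<Longrightarrow> swap_eq V m l"
| add: "swap_eq V m k \<Longrightarrow> (\<And>e. e \<in> Poly_Mapping.keys l \<Longrightarrow> e \<subseteq> V \<and> card e = 2) \<Longrightarrow>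
    swap_eq V (m + l) (k + l)"
| pivot: "{a, b, c, x} \<subseteq> V \<Longrightarrow> b \<notin> {a, c} \<Longrightarrow> x \<notin> {a, c} \<Longrightarrow>
    swap_eq V (edge a b + edge b c) (edge a x + edge x c)"
| cross: "{a, b, c, d} \<subseteq> V \<Longrightarrow> b \<notin> {a, d} \<Longrightarrow> c \<notin> {a, d} \<Longrightarrow>
    swap_eq V (edge a b + edge c d) (edge a c + edge b d)"

lemma swap_eq_invariant:
  assumes "swap_eq V m k"
  shows "mono_deg m = mono_deg k" "even (vdeg m v) = even (vdeg k v)"
proof -
  have "mono_deg m = mono_deg k \<and> even (vdeg m v) = even (vdeg k v)"
    using assms by induction (auto simp: mono_deg_add vdeg_add vdeg_edge)
  then show "mono_deg m = mono_deg k" "even (vdeg m v) = even (vdeg k v)" by auto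
qed

locale complete_edges =
  fixes V :: "'v set" and E :: "'v set set"
  assumes complete: "complete_graph V E"
begin

definition supported :: "('v set \<Rightarrow>\<^sub>0 nat) \<Rightarrow> bool" where
  "supported m \<longleftrightarrow> Poly_Mapping.keys m \<subseteq> E"

abbreviation swap (infix "\<approx>" 50) where "m \<approx> k \<equiv> swap_eq V m k"

definition reaches :: "('v set \<Rightarrow>\<^sub>0 nat) \<Rightarrow> 'v \<Rightarrow> 'v \<Rightarrow> bool" where
  "reaches m u v \<longleftrightarrow> (\<exists>k. supported k \<and> m \<approx> edge u v + k)"

lemma edge_mem_iff: "{a, b} \<in> E \<longleftrightarrow> a \<in> V \<and> b \<in> V \<and> a \<noteq> b"
  using complete by (auto simp: complete_graph_def simple_graph_def card_2_iff)

lemma edge_cases: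
  assumes "e \<in> E"
  obtains a b where "e = {a, b}" "a \<in> V" "b \<in> V" "a \<noteq> b"
  using assms complete by (auto simp: complete_graph_def simple_graph_def card_2_iff)

lemma supported_add [simp]: "supported (m + k) \<longleftrightarrow> supported m \<and> supported k"
  by (simp add: supported_def keys_add_nat)

lemma supported_edge [simp]: "supported (edge a b) \<longleftrightarrow> a \<in> V \<and> b \<in> V \<and> a \<noteq> b"
  by (simp add: supported_def edge_mem_iff)

lemma split_edge:
  assumes "supported m" "e \<in> Poly_Mapping.keys m"
  obtains a b k where "e = {a, b}" "a \<in> V" "b \<in> V" "a \<noteq> b" "m = edge a b + k" "supported k"
proof -
  have "e \<in> E" using assms by (auto simp: supported_def)
  then obtain a b where e: "e = {a, b}" "a \<in> V" "b \<in> V" "a \<noteq> b" by (rule edge_cases)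
  obtain k where "m = unit_exp e + k" using assms(2) by (rule split_off_unit_exp)
  then show thesis using that[OF e] assms(1) e(1) by (simp add: edge_def supported_def keys_add_nat)
qed

lemma split_given_edge:
  assumes "supported m" "{u, v} \<in> Poly_Mapping.keys m"
  obtains k where "m = edge u v + k" "supported k"
proof -
  obtain k where "m = unit_exp {u, v} + k" using assms(2) by (rule split_off_unit_exp)
  then show thesis using that assms(1) by (simp add: edge_def supported_def keys_add_nat)
qed

lemma split_edge_at:
  assumes "supported m" "e \<in> Poly_Mapping.keys m" "u \<in> e"
  obtains a k where "e = {u, a}" "u \<in> V" "a \<in> V" "u \<noteq> a" "m = edge u a + k" "supported k"
proof -
  obtain a b k where *: "e = {a, b}" "a \<in> V" "b \<in> V" "a \<noteq> b" "m = edge a b + k" "supported k"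
    using assms(1,2) by (rule split_edge)
  show thesis
  proof (cases "u = a")
    case True
    then show thesis using * that by auto
  next
    case False
    then show thesis using * that[of a k] assms(3) by (auto simp: insert_commute edge_commute)
  qed
qed

lemma swap_add: "m \<approx> k \<Longrightarrow> supported l \<Longrightarrow> m + l \<approx> k + l"
  using complete
  by (intro swap_eq.add) (auto simp: supported_def complete_graph_def simple_graph_def)

lemma pivot_add:
  "{a, b, c, x} \<subseteq> V \<Longrightarrow> b \<notin> {a, c} \<Longrightarrow> x \<notin> {a, c} \<Longrightarrow> supported k \<Longrightarrow>
    edge a b + edge b c + k \<approx> edge a x + edge x c + k"
  by (intro swap_add swap_eq.pivot)

lemma cross_add:
  "{a, b, c, d} \<subseteq> V \<Longrightarrow> b \<notin> {a, d} \<Longrightarrow> c \<notin> {a, d} \<Longrightarrow> supported k \<Longrightarrow>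
    edge a b + edge c d + k \<approx> edge a c + edge b d + k"
  by (intro swap_add swap_eq.cross)

lemma reachesI: "m \<approx> edge u v + k \<Longrightarrow> supported k \<Longrightarrow> reaches m u v"
  unfolding reaches_def by blast

lemma reaches_commute: "reaches m u v \<longleftrightarrow> reaches m v u"
  by (simp add: reaches_def edge_commute)

lemma reaches_trans: "m \<approx> k \<Longrightarrow> reaches k u v \<Longrightarrow> reaches m u v"
  unfolding reaches_def by (blast intro: swap_eq.trans)

lemma reaches_self: "supported k \<Longrightarrow> reaches (edge u v + k) u v"
  by (rule reachesI[OF swap_eq.refl])

lemma reaches_pivot:
  assumes "{a, b, c, x} \<subseteq> V" "b \<notin> {a, c}" "x \<notin> {a, c}" "supported k"
  shows "reaches (edge a b + edge b c + k) a x"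
  by (rule reachesI[of _ _ _ "edge x c + k"])
    (use pivot_add[OF assms] assms in \<open>auto simp: add.assoc\<close>)

lemma reaches_cross:
  assumes "{a, b, c, d} \<subseteq> V" "b \<notin> {a, d}" "c \<notin> {a, d}" "supported k"
  shows "reaches (edge a b + edge c d + k) a c"
  by (rule reachesI[of _ _ _ "edge b d + k"])
    (use cross_add[OF assms] assms in \<open>auto simp: add.assoc\<close>)

text \<open>
  A doubled edge can be moved anywhere: with \<open>a = c\<close> a pivot turns it about one of its ends. One
  turn brings an end into \<open>{u, v}\<close>, a second one makes it the doubled edge \<open>uv\<close>.
\<close>

lemma reaches_from_square:
  assumes V: "{a, b, u, v} \<subseteq> V" and "a \<noteq> b" "u \<noteq> v" and k: "supported k"
  shows "reaches (edge a b + edge a b + k) u v"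
proof -
  have step: "edge p q + edge p q + k \<approx> edge p x + edge p x + k"
    if "p \<in> V" "q \<in> V" "x \<in> V" "p \<noteq> q" "p \<noteq> x" for p q x
    using pivot_add[of p q p x k] that k by (simp add: edge_commute[of _ p])
  have at: "reaches (edge p q + edge p q + k) u v"
    if p: "p \<in> {u, v}" and "q \<in> V" "p \<noteq> q" for p q
  proof -
    obtain r where r: "{u, v} = {p, r}" "r \<in> V" "p \<noteq> r" "p \<in> V"
      using p V \<open>u \<noteq> v\<close> by auto
    have "edge p q + edge p q + k \<approx> edge u v + (edge u v + k)"
      using step[of p q r] that r by (simp add: edge_def add.assoc)
    then show ?thesis by (rule reachesI) (use assms in auto)
  qed
  show ?thesis
  proof (cases "a \<in> {u, v} \<or> b \<in> {u, v}")
    case True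
    then show ?thesis using at[of a b] at[of b a] assms by (auto simp: edge_commute)
  next
    case False
    then have "edge a b + edge a b + k \<approx> edge u a + edge u a + k"
      using step[of a b u] assms by (simp add: edge_commute)
    then show ?thesis
      by (rule reaches_trans) (use at[of u a] False assms in auto)
  qed
qed

text \<open>
  If \<open>u\<close> and \<open>v\<close> lie on disjoint edges, one \<open>cross\<close> joins them. The remaining situation is a path
  \<open>u a v\<close>, where a third edge is needed; wherever it lies relative to \<open>u\<close>, \<open>a\<close>, \<open>v\<close>, it lets the
  edge \<open>uv\<close> be produced. So the single exception is the path alone.
\<close>

lemma reaches_covered:
  assumes m: "supported m" and "u \<noteq> v"
    and "e1 \<in> Poly_Mapping.keys m" "u \<in> e1" "e2 \<in> Poly_Mapping.keys m" "v \<in> e2"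
  shows "reaches m u v \<or> (\<exists>a. a \<notin> {u, v} \<and> m = edge u a + edge a v)"
proof -
  obtain a m1 where a: "e1 = {u, a}" "u \<in> V" "a \<in> V" "u \<noteq> a" "m = edge u a + m1" "supported m1"
    using m assms(3,4) by (rule split_edge_at)
  show ?thesis
  proof (cases "a = v")
    case True
    then show ?thesis using a reaches_self by simp
  next
    case av: False
    then have e2: "e2 \<in> Poly_Mapping.keys m1" using assms a by (auto simp: keys_add_nat)
    obtain b m2 where b: "e2 = {v, b}" "v \<in> V" "b \<in> V" "v \<noteq> b" "m1 = edge v b + m2"
      "supported m2"
      using a(6) e2 assms(6) by (rule split_edge_at)
    have m_eq: "m = edge u a + edge v b + m2" using a b by (simp add: add.assoc)
    show ?thesis
    proof (cases "a = b")
      case False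
      then have "b = u \<or> reaches m u v"
        using reaches_cross[of u a v b m2] a b av assms(2) by (auto simp: m_eq)
      moreover have "reaches m u v" if "b = u"
        using reaches_self[of "edge u a + m2" u v] a b that
        by (simp add: m_eq edge_commute ac_simps)
      ultimately show ?thesis by blast
    next
      case ab: True
      show ?thesis
      proof (cases "m2 = 0")
        case True
        then show ?thesis using m_eq ab av a by (auto simp: edge_commute)
      next
        case False
        \<comment> \<open>A third edge \<open>pw\<close> at an end of the path \<open>p a q\<close>: pivoting the path from \<open>a\<close> to \<open>w\<close> doubles
          \<open>pw\<close>. It is applied with \<open>p = u\<close> and with \<open>p = v\<close>.\<close>
        have star: "reaches (edge p a + edge a q + edge p w + k) p q"
          if "p \<in> V" "q \<in> V" "w \<in> V" "p \<noteq> q" "p \<noteq> a" "q \<noteq> a" "p \<noteq> w" "supported k" for p q w k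
        proof (cases "w = q")
          case True
          then show ?thesis
            using reaches_self[of "edge p a + edge a q + k" p q] that a by (simp add: ac_simps)
        next
          case False
          have "edge p a + edge a q + edge p w + k \<approx> edge p w + edge p w + (edge w q + k)"
            using pivot_add[of p a q w "edge p w + k"] that False a by (simp add: ac_simps)
          then show ?thesis
            by (rule reaches_trans) (use reaches_from_square that False in auto)
        qed
        obtain e where e: "e \<in> Poly_Mapping.keys m2" using False by (auto simp flip: keys_eq_empty)
        consider "u \<in> e" | "v \<in> e" | "a \<in> e" "u \<notin> e" "v \<notin> e" | "u \<notin> e" "v \<notin> e" "a \<notin> e" by blast
        then show ?thesis
        proof cases
          case 1
          obtain w k where w: "w \<in> V" "u \<noteq> w" "m2 = edge u w + k" "supported k"
            using b(6) e 1 by (rule split_edge_at)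
          then have "reaches m u v"
            using star[of u v w k] assms(2) a b ab by (simp add: m_eq edge_commute ac_simps)
          then show ?thesis ..
        next
          case 2
          obtain w k where w: "w \<in> V" "v \<noteq> w" "m2 = edge v w + k" "supported k"
            using b(6) e 2 by (rule split_edge_at)
          then have "reaches m v u"
            using star[of v u w k] assms(2) a b ab by (simp add: m_eq edge_commute ac_simps)
          then show ?thesis by (simp add: reaches_commute)
        next
          case 3
          obtain w k where w: "e = {a, w}" "w \<in> V" "a \<noteq> w" "m2 = edge a w + k" "supported k"
            using b(6) e 3(1) by (rule split_edge_at)
          then have "reaches m u v"
            using reaches_pivot[of u a w v "edge v a + k"] 3 assms(2) a b ab
            by (auto simp: m_eq ac_simps)
          then show ?thesis ..
        next
          case 4
          obtain w z k where w: "e = {w, z}" "w \<in> V" "z \<in> V" "w \<noteq> z" "m2 = edge w z + k"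
            "supported k"
            using b(6) e by (rule split_edge)
          have "m \<approx> edge u w + edge v a + (edge a z + k)"
            using cross_add[of u a w z "edge v a + k"] 4 w a b ab by (auto simp: m_eq ac_simps)
          then have "reaches m u v"
            by (rule reaches_trans)
              (use reaches_cross[of u w v a "edge a z + k"] 4 w a b ab assms(2) in auto)
          then show ?thesis ..
        qed
      qed
    qed
  qed
qed

text \<open>
  Let \<open>u\<close> be isolated in \<open>m\<close>. By parity \<open>m'\<close> then has a second edge \<open>ux\<close> besides \<open>uv\<close>, and if
  \<open>x \<noteq> v\<close> pivoting the path \<open>v u x\<close> lets \<open>m'\<close> reach every edge from \<open>v\<close> or \<open>x\<close> to a vertex outside
  \<open>{v, x}\<close>. So it is enough that \<open>m\<close> reaches one such edge. Otherwise \<open>v\<close> and \<open>x\<close> are either joined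
  by an edge of \<open>m\<close>, and the equality of degrees supplies another edge of \<open>m\<close> to cross it with, or
  both isolated in \<open>m\<close>, and then parity at \<open>v\<close> gives \<open>m'\<close> enough edges to reach any edge of \<open>m\<close>.
\<close>

lemma common_edge_uncovered:
  assumes m: "supported m" "supported m'"
    and par: "\<And>x. even (vdeg m x) = even (vdeg m' x)" and deg: "mono_deg m = mono_deg m'"
    and uv: "{u, v} \<in> Poly_Mapping.keys m'"
    and u: "\<And>e. e \<in> Poly_Mapping.keys m \<Longrightarrow> u \<notin> e"
  shows "\<exists>p\<in>V. \<exists>q\<in>V. p \<noteq> q \<and> reaches m p q \<and> reaches m' p q"
proof -
  have "{u, v} \<in> E" using m uv by (auto simp: supported_def)
  then have V: "u \<in> V" "v \<in> V" "u \<noteq> v" by (auto simp: edge_mem_iff)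
  obtain k1 where k1: "m' = edge u v + k1" "supported k1"
    using m(2) uv by (rule split_given_edge)
  have "even (vdeg m' u)" using par[of u] vdeg_uncovered[of m u] u by simp
  then have "odd (vdeg k1 u)" using k1 V by (simp add: vdeg_add vdeg_edge)
  then obtain e where e: "e \<in> Poly_Mapping.keys k1" "u \<in> e"
    using odd_vdeg_covered[of k1 u] by blast
  obtain x k2 where x: "x \<in> V" "u \<noteq> x" "k1 = edge u x + k2" "supported k2"
    using k1(2) e by (rule split_edge_at)
  have m'_eq: "m' = edge v u + edge u x + k2" using k1 x by (simp add: ac_simps edge_commute)
  have deg_m: "mono_deg m = 2 + mono_deg k2" using deg by (simp add: m'_eq mono_deg_add)
  then obtain f where f: "f \<in> Poly_Mapping.keys m"
    by (metis add_is_0 ex_in_conv keys_eq_empty mono_deg_eq_0_iff zero_neq_numeral)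
  show ?thesis
  proof (cases "x = v")
    case True
    obtain p q l where p: "p \<in> V" "q \<in> V" "p \<noteq> q" "m = edge p q + l" "supported l"
      using m(1) f by (rule split_edge)
    have "reaches m' p q"
      using reaches_from_square[of u v p q k2] V p x True by (simp add: m'_eq edge_commute)
    then show ?thesis using p reaches_self by blast
  next
    case xv: False
    have P: "reaches m' v y" "reaches m' x y" if "y \<in> V" "y \<notin> {v, x}" for y
      using reaches_pivot[of v u x y k2] reaches_pivot[of x u v y k2] that V x
      by (simp_all add: m'_eq edge_commute ac_simps)
    show ?thesis
    proof (cases "\<exists>s\<in>{v, x}. \<exists>y\<in>V. y \<notin> {v, x} \<and> reaches m s y")
      case True
      then show ?thesis using P V x by (metis insert_iff singletonD)
    next
      case no: False
      have at: "e = {v, x}" if l: "supported l" "m = l + l'" "supported l'"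
        and e: "e \<in> Poly_Mapping.keys l" and s: "s \<in> e" "s \<in> {v, x}"
        for l l' e s
      proof -
        obtain y k where y: "e = {s, y}" "y \<in> V" "s \<noteq> y" "l = edge s y + k" "supported k"
          using l(1) e s(1) by (rule split_edge_at)
        have "reaches m s y"
          using reaches_self[of "k + l'" s y] y l by (simp add: ac_simps)
        then have "y \<in> {v, x}" using no s y by blast
        then show ?thesis using y s by auto
      qed
      have at0: "e = {v, x}" if "e \<in> Poly_Mapping.keys m" "s \<in> e" "s \<in> {v, x}" for e s
        using at[of m 0 e s] m(1) that by (simp add: supported_def)
      show ?thesis
      proof (cases "{v, x} \<in> Poly_Mapping.keys m")
        case True
        obtain l where l: "m = edge v x + l" "supported l"
          using m(1) True by (rule split_given_edge)
        have "l \<noteq> 0" using deg_m l by (auto simp: mono_deg_add)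
        then obtain e where e: "e \<in> Poly_Mapping.keys l" by (auto simp flip: keys_eq_empty)
        obtain y z k where y: "e = {y, z}" "y \<in> V" "z \<in> V" "y \<noteq> z" "l = edge y z + k" "supported k"
          using l(2) e by (rule split_edge)
        show ?thesis
        proof (cases "v \<in> e \<or> x \<in> e")
          case True
          then have "e = {v, x}" using at0[of e] e l by (auto simp: keys_add_nat)
          then have "m = edge v x + edge v x + k" using l y by (simp add: edge_def ac_simps)
          then have "reaches m u v"
            using reaches_from_square[of v x u v k] V x xv y by auto
          then show ?thesis using k1 V reaches_self by blast
        next
          case False
          then have "reaches m v y"
            using reaches_cross[of v x y z k] l y V x xv by (auto simp: add.assoc)
          then show ?thesis using no False y by auto
        qed
      next
        case False
        then have free: "e \<in> Poly_Mapping.keys m \<Longrightarrow> v \<notin> e \<and> x \<notin> e" for e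
          using at0[of e] by blast
        obtain y z l where y: "f = {y, z}" "y \<in> V" "z \<in> V" "y \<noteq> z" "m = edge y z + l"
          "supported l"
          using m(1) f by (rule split_edge)
        have yz: "y \<notin> {u, v, x}" "z \<notin> {u, v, x}" using free[OF f] u[OF f] y by auto
        \<comment> \<open>The path \<open>v u x\<close> becomes \<open>v y x\<close>, which uses up one edge at \<open>v\<close>. As \<open>v\<close> has even degree in
          \<open>m'\<close>, a further edge \<open>vw\<close> is left, and it carries the new edge at \<open>y\<close> over to \<open>z\<close>.\<close>
        have m'_y: "m' \<approx> edge v y + edge y x + k2"
          using pivot_add[of v u x y k2] V x y yz by (simp add: m'_eq)
        have "even (vdeg m' v)" using par[of v] vdeg_uncovered[of m v] free by simp
        then have "odd (vdeg k2 v)"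
          using V x xv by (simp add: m'_eq vdeg_add vdeg_edge)
        then obtain e where e: "e \<in> Poly_Mapping.keys k2" "v \<in> e"
          using odd_vdeg_covered[of k2 v] by blast
        obtain w k3 where w: "w \<in> V" "v \<noteq> w" "k2 = edge v w + k3" "supported k3"
          using x(4) e by (rule split_edge_at)
        have "reaches m' y z"
        proof (cases "w = z")
          case False
          have "edge v y + edge y x + k2 = edge y v + edge v w + (edge y x + k3)"
            using w by (simp add: ac_simps edge_commute)
          moreover have "reaches \<dots> y z"
            using reaches_pivot[of y v w z "edge y x + k3"] w x y yz V False by auto
          ultimately show ?thesis using reaches_trans[OF m'_y] by simp
        next
          case True
          have "edge v y + edge y x + k2 = edge z v + edge y x + (edge v y + k3)"
            using w True by (simp add: ac_simps edge_commute)
          moreover have "reaches \<dots> z y"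
            using reaches_cross[of z v y x "edge v y + k3"] w x y yz V xv by auto
          ultimately show ?thesis using reaches_trans[OF m'_y] reaches_commute by simp
        qed
        then show ?thesis using y reaches_self by blast
      qed
    qed
  qed
qed

text \<open>
  This makes induction on the number of edges possible: a shared edge can be cancelled.
\<close>

lemma common_edge:
  assumes m: "supported m" "supported m'"
    and par: "\<And>x. even (vdeg m x) = even (vdeg m' x)" and deg: "mono_deg m = mono_deg m'"
    and "m' \<noteq> 0"
  shows "\<exists>p\<in>V. \<exists>q\<in>V. p \<noteq> q \<and> reaches m p q \<and> reaches m' p q"
proof -
  obtain e where e: "e \<in> Poly_Mapping.keys m'" using assms(5) by (auto simp flip: keys_eq_empty)
  obtain u v k where u: "e = {u, v}" "u \<in> V" "v \<in> V" "u \<noteq> v" "m' = edge u v + k" "supported k"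
    using m(2) e by (rule split_edge)
  show ?thesis
  proof (cases "(\<exists>e1\<in>Poly_Mapping.keys m. u \<in> e1) \<and> (\<exists>e2\<in>Poly_Mapping.keys m. v \<in> e2)")
    case False
    then show ?thesis
      using common_edge_uncovered[OF m par deg, of u v] common_edge_uncovered[OF m par deg, of v u]
        e u(1) by (auto simp: insert_commute)
  next
    case True
    then consider "reaches m u v" | a where "a \<notin> {u, v}" "m = edge u a + edge a v"
      using reaches_covered[OF m(1) u(4)] by blast
    then show ?thesis
    proof cases
      case 1
      then show ?thesis using u reaches_self by blast
    next
      \<comment> \<open>Here \<open>m\<close> is just the path \<open>u a v\<close>. As \<open>m'\<close> contains \<open>uv\<close>, all parities of its only other edge
        would have to be even, which fails at an end of that edge.\<close>
      case (2 a)
      then have "mono_deg k = 1" using deg u(5) by (simp add: mono_deg_add)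
      then obtain f where f: "f \<in> Poly_Mapping.keys k"
        by (metis ex_in_conv keys_eq_empty mono_deg_eq_0_iff zero_neq_one)
      obtain p q l where p: "p \<noteq> q" "k = edge p q + l"
        using u(6) f by (rule split_edge)
      with \<open>mono_deg k = 1\<close> have "k = edge p q" by (simp add: mono_deg_add)
      then have "odd (vdeg m' p) = even (vdeg (edge u v) p)"
        using u(5) p(1) by (simp add: vdeg_add vdeg_edge)
      moreover have "even (vdeg m p) = even (vdeg (edge u v) p)"
        using 2 u(4) by (auto simp: vdeg_add vdeg_edge)
      ultimately show ?thesis using par[of p] by simp
    qed
  qed
qed

text \<open>
  Shared edges are produced and cancelled one at a time until nothing is left. Together with
  \<open>swap_eq_invariant\<close>: the number of edges and the parities of the vertex degrees are a complete set
  of invariants for the exchange of edges in a complete graph.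
\<close>

theorem swap_eq_if_same_invariants:
  assumes "supported m" "supported m'" "mono_deg m = mono_deg m'"
    and "\<And>x. even (vdeg m x) = even (vdeg m' x)"
  shows "m \<approx> m'"
  using assms
proof (induction "mono_deg m" arbitrary: m m')
  case 0
  then show ?case by (metis mono_deg_eq_0_iff swap_eq.refl)
next
  case (Suc d)
  have "m' \<noteq> 0" using Suc by (auto simp flip: mono_deg_eq_0_iff)
  then obtain p q where "p \<in> V" "q \<in> V" "p \<noteq> q" "reaches m p q" "reaches m' p q"
    using common_edge[OF Suc.prems(1,2,4,3)] by blast
  then obtain k k' where k: "supported k" "supported k'" "m \<approx> edge p q + k" "m' \<approx> edge p q + k'"
    by (auto simp: reaches_def)
  have "d = mono_deg k" "mono_deg k = mono_deg k'"
    using swap_eq_invariant(1)[OF k(3)] swap_eq_invariant(1)[OF k(4)] Suc by (auto simp: mono_deg_add)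
  moreover have "even (vdeg k x) = even (vdeg k' x)" for x
    using swap_eq_invariant(2)[OF k(3), of x] swap_eq_invariant(2)[OF k(4), of x] Suc.prems(4)[of x]
    by (auto simp: vdeg_add)
  ultimately have "k \<approx> k'" using Suc.hyps k by blast
  then have "edge p q + k \<approx> edge p q + k'"
    using swap_add[of k k' "edge p q"] \<open>p \<in> V\<close> \<open>q \<in> V\<close> \<open>p \<noteq> q\<close> by (simp add: add.commute)
  then show ?case using k by (blast intro: swap_eq.trans swap_eq.sym)
qed

end

section \<open>Functionals vanishing on the differences of squares\<close>

definition pairing :: "(('x \<Rightarrow>\<^sub>0 nat) \<Rightarrow> 'k::comm_ring_1) \<Rightarrow> ('x, 'k) mpoly \<Rightarrow> 'k" where
  "pairing h p = (\<Sum>m\<in>Poly_Mapping.keys p. Poly_Mapping.lookup p m * h m)"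

lemma pairing_add: "pairing h (p + q) = pairing h p + pairing h q"
  unfolding pairing_def by (rule setsum_keys_plus_distrib) (simp_all add: distrib_right)

lemma pairing_0 [simp]: "pairing h 0 = 0"
  by (simp add: pairing_def)

lemma pairing_single [simp]: "pairing h (Poly_Mapping.single m c) = c * h m"
  by (simp add: pairing_def)

lemma pairing_diff: "pairing h (p - q) = pairing h p - pairing h q"
  using pairing_add[of h "p - q" q] by simp

lemma pairing_single_mult:
  "pairing h (Poly_Mapping.single a c * p) = c * pairing (\<lambda>m. h (a + m)) p"
  by (induction p rule: mpoly_induct) (simp_all add: mult_single pairing_add distrib_left mult.assoc)

text \<open>
  Modulo the differences \<open>x\<^sub>i\<^sup>2 - x\<^sub>j\<^sup>2\<close> a monomial depends only on its degree and on the parities of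
  its exponents. The functions of these data give the linear functionals that detect membership in
  the ideal generated by the differences.
\<close>

definition parity_invariant :: "(('v \<Rightarrow>\<^sub>0 nat) \<Rightarrow> 'k) \<Rightarrow> bool" where
  "parity_invariant h \<longleftrightarrow> (\<forall>m k. mono_deg m = mono_deg k \<and>
    (\<forall>v. even (Poly_Mapping.lookup m v) = even (Poly_Mapping.lookup k v)) \<longrightarrow> h m = h k)"

lemma parity_invariant_shift:
  "parity_invariant h \<Longrightarrow> parity_invariant (\<lambda>m. h (a + m))"
  unfolding parity_invariant_def by (simp add: mono_deg_add lookup_add)

lemma mvar_power2: "mvar i ^ 2 = Poly_Mapping.single (unit_exp i + unit_exp i) 1"
  by (simp add: mvar_eq_single power2_eq_square mult_single)

lemma square_diff_generators_closed:
  "{mvar i ^ 2 - mvar j ^ 2 | i j. i \<in> V \<and> j \<in> V}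
    \<subseteq> carrier (mpoly_ring V :: ('v, 'k::comm_ring_1) mpoly ring)"
  by (auto intro!: mpoly_ring_diff_closed mpoly_ring_power_closed mvar_closed)

lemma square_diff_ideal_ideal:
  "ideal (square_diff_ideal V) (mpoly_ring V :: ('v, 'k::comm_ring_1) mpoly ring)"
  unfolding square_diff_ideal_def
  by (rule genideal_mpoly_ideal[OF square_diff_generators_closed])

lemma square_diff_mem:
  "i \<in> V \<Longrightarrow> j \<in> V \<Longrightarrow> mvar i ^ 2 - mvar j ^ 2 \<in> square_diff_ideal V"
  unfolding square_diff_ideal_def
  by (rule subsetD[OF genideal_mpoly_superset[OF square_diff_generators_closed]]) blast

text \<open>
  The common kernel of these functionals is an ideal, because a parity invariant function composed
  with the shift by a monomial is parity invariant again.
\<close>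

lemma pairing_square_diff_ideal:
  fixes g :: "('v, 'k::comm_ring_1) mpoly"
  assumes "g \<in> square_diff_ideal V" "parity_invariant h"
  shows "pairing h g = 0"
proof -
  define Z where "Z = {g \<in> carrier (mpoly_ring V :: ('v, 'k) mpoly ring).
    \<forall>h. parity_invariant h \<longrightarrow> pairing h g = 0}"
  have "ideal Z (mpoly_ring V)"
    by (rule mpoly_idealI)
      (auto simp: Z_def pairing_add pairing_single_mult parity_invariant_shift
        intro: mpoly_ring_zero_closed mpoly_ring_add_closed mpoly_ring_mult_closed single_closed)
  moreover have "pairing h (mvar i ^ 2 - mvar j ^ 2) = 0"
    if "parity_invariant h" for h :: "('v \<Rightarrow>\<^sub>0 nat) \<Rightarrow> 'k" and i j
    using that[unfolded parity_invariant_def, rule_format,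
        of "unit_exp i + unit_exp i" "unit_exp j + unit_exp j"]
    by (simp add: mvar_power2 pairing_diff mono_deg_add lookup_add)
  then have "{mvar i ^ 2 - mvar j ^ 2 | i j. i \<in> V \<and> j \<in> V} \<subseteq> Z"
    by (auto simp: Z_def intro!: mpoly_ring_diff_closed mpoly_ring_power_closed mvar_closed)
  ultimately have "square_diff_ideal V \<subseteq> Z"
    unfolding square_diff_ideal_def by (rule genideal_mpoly_least)
  then show ?thesis using assms by (auto simp: Z_def)
qed

section \<open>The Eulerian ideal of a complete graph\<close>

lemma mvar_power: "mvar x ^ k = Poly_Mapping.single (Poly_Mapping.single x k) (1::'k::comm_ring_1)"
  by (induction k) (simp_all add: mvar_def mult_single flip: single_add)

lemma prod_single:
  "(\<Prod>x\<in>A. Poly_Mapping.single (a x) (1::'k::comm_ring_1)) = Poly_Mapping.single (sum a A) 1"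
  by (induction A rule: infinite_finite_induct) (simp_all add: mult_single)

lemma edge_hom_single:
  "edge_hom (Poly_Mapping.single m c) = Poly_Mapping.single (incidence m) (c::'k::comm_ring_1)"
proof -
  have "edge_hom (Poly_Mapping.single m c) =
      mconst c * (\<Prod>e\<in>Poly_Mapping.keys m. \<Prod>v\<in>e. mvar v ^ Poly_Mapping.lookup m e)"
    by (simp add: edge_hom_def mpoly_subst_single prod_power_distrib)
  also have "\<dots> = mconst c * Poly_Mapping.single (incidence m) 1"
    by (simp add: mvar_power prod_single incidence_def)
  finally show ?thesis by (simp add: mconst_def mult_single)
qed

lemma edge_hom_add: "edge_hom (p + q) = edge_hom p + edge_hom q"
  by (simp add: edge_hom_def mpoly_subst_add)

lemma edge_hom_diff: "edge_hom (p - q) = edge_hom p - edge_hom q"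
  using edge_hom_add[of "p - q" q] by simp

lemma edge_hom_mult: "edge_hom (p * q) = edge_hom p * edge_hom q"
  by (simp add: edge_hom_def mpoly_subst_mult)

lemma pairing_edge_hom: "pairing h (edge_hom p) = pairing (\<lambda>m. h (incidence m)) p"
  by (induction p rule: mpoly_induct) (simp_all add: edge_hom_add edge_hom_single pairing_add)

text \<open>
  Taking every such binomial in the ideal, rather than just those of the two moves, spares an
  explicit description; with finitely many edges there are still only finitely many.
\<close>

definition quadric_binomials ::
    "'v set \<Rightarrow> 'v set set \<Rightarrow> ('v set, 'k::comm_ring_1) mpoly set" where
  "quadric_binomials V E = eulerian_ideal V E \<inter>
    (\<lambda>(e, f, g, h). mvar e * mvar f - mvar g * mvar h) ` (E \<times> E \<times> E \<times> E)"

lemma mvar_mult_mvar: "mvar e * mvar f = Poly_Mapping.single (unit_exp e + unit_exp f) 1"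
  by (simp add: mvar_eq_single mult_single)

context complete_edges
begin

lemma simple: "simple_graph V E"
  using complete by (simp add: complete_graph_def)

lemma finite_E: "finite E"
  using simple finite_subset[of E "Pow V"] by (auto simp: simple_graph_def)

lemma eulerian_ideal: "ideal (eulerian_ideal V E) (mpoly_ring E)"
  by (rule eulerian_ideal_ideal[OF simple])

lemma quadric_binomials_closed: "quadric_binomials V E \<subseteq> carrier (mpoly_ring E)"
  using mpoly_ideal_carrier[OF eulerian_ideal] by (auto simp: quadric_binomials_def)

lemma quadric_ideal:
  "ideal (genideal (mpoly_ring E) (quadric_binomials V E)) (mpoly_ring E)"
  by (rule genideal_mpoly_ideal[OF quadric_binomials_closed])

lemma quadric_ideal_subset:
  "genideal (mpoly_ring E) (quadric_binomials V E) \<subseteq> eulerian_ideal V E"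
  by (rule genideal_mpoly_least[OF eulerian_ideal]) (auto simp: quadric_binomials_def)

lemma quadric_binomialI:
  assumes "{e, f, g, h} \<subseteq> E"
    and "edge_hom (mvar e * mvar f) - edge_hom (mvar g * mvar h)
      \<in> (square_diff_ideal V :: ('v, 'k::comm_ring_1) mpoly set)"
  shows "mvar e * mvar f - mvar g * mvar h
    \<in> (quadric_binomials V E :: ('v set, 'k) mpoly set)"
  using assms
  by (auto simp: quadric_binomials_def eulerian_ideal_def edge_hom_diff
      intro!: mpoly_ring_diff_closed mpoly_ring_mult_closed mvar_closed
        image_eqI[where x = "(e, f, g, h)"])

lemma pivot_binomial:
  assumes "{a, b, c, x} \<subseteq> V" "b \<notin> {a, c}" "x \<notin> {a, c}"
  shows "mvar {a, b} * mvar {b, c} - mvar {a, x} * mvar {x, c}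
    \<in> (quadric_binomials V E :: ('v set, 'k::comm_ring_1) mpoly set)"
proof (rule quadric_binomialI)
  have "mvar a * mvar c * (mvar b ^ 2 - mvar x ^ 2)
      \<in> (square_diff_ideal V :: ('v, 'k) mpoly set)"
    using assms by (intro mpoly_ideal_mult[OF square_diff_ideal_ideal] square_diff_mem
        mpoly_ring_mult_closed mvar_closed) auto
  moreover have "edge_hom (mvar {a, b} * mvar {b, c}) - edge_hom (mvar {a, x} * mvar {x, c}) =
      mvar a * mvar c * (mvar b ^ 2 - mvar x ^ 2 :: ('v, 'k) mpoly)"
    using assms by (auto simp: edge_hom_mult edge_hom_mvar power2_eq_square algebra_simps)
  ultimately show "edge_hom (mvar {a, b} * mvar {b, c}) - edge_hom (mvar {a, x} * mvar {x, c})
      \<in> (square_diff_ideal V :: ('v, 'k) mpoly set)"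
    by simp
qed (use assms in \<open>auto simp: edge_mem_iff\<close>)

lemma cross_binomial:
  assumes "{a, b, c, d} \<subseteq> V" "b \<notin> {a, d}" "c \<notin> {a, d}"
  shows "mvar {a, b} * mvar {c, d} - mvar {a, c} * mvar {b, d} \<in> quadric_binomials V E"
proof (rule quadric_binomialI)
  have "edge_hom (mvar {a, b} * mvar {c, d}) - edge_hom (mvar {a, c} * mvar {b, d}) = 0"
    using assms by (auto simp: edge_hom_mult edge_hom_mvar algebra_simps)
  then show "edge_hom (mvar {a, b} * mvar {c, d}) - edge_hom (mvar {a, c} * mvar {b, d})
      \<in> square_diff_ideal V"
    using mpoly_ideal_zero[OF square_diff_ideal_ideal] by metis
qed (use assms in \<open>auto simp: edge_mem_iff\<close>)

lemma swap_eq_binomial: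
  assumes "m \<approx> k"
  shows "Poly_Mapping.single m 1 - Poly_Mapping.single k (1::'k::comm_ring_1)
    \<in> genideal (mpoly_ring E) (quadric_binomials V E)" (is "_ \<in> ?J")
  using assms
proof induction
  case (refl m)
  show ?case using mpoly_ideal_zero[OF quadric_ideal] by simp
next
  case (sym m k)
  then show ?case using mpoly_ideal_uminus[OF quadric_ideal] by fastforce
next
  case (trans m k l)
  then show ?case using mpoly_ideal_add[OF quadric_ideal] by fastforce
next
  case (add m k l)
  then have "Poly_Mapping.keys l \<subseteq> E" using edge_mem_iff by (fastforce simp: card_2_iff)
  from mpoly_ideal_mult[OF quadric_ideal add.IH single_closed[OF this, of "1::'k"]]
  show ?case by (simp add: right_diff_distrib mult_single add.commute)
next
  case (pivot a b c x)
  then show ?case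
    using subsetD[OF genideal_mpoly_superset[OF quadric_binomials_closed] pivot_binomial]
    by (simp add: mvar_mult_mvar edge_def)
next
  case (cross a b c d)
  then show ?case
    using subsetD[OF genideal_mpoly_superset[OF quadric_binomials_closed] cross_binomial]
    by (simp add: mvar_mult_mvar edge_def)
qed

lemma mono_deg_incidence: "supported m \<Longrightarrow> mono_deg (incidence m) = 2 * mono_deg m"
proof (induction "mono_deg m" arbitrary: m)
  case 0
  then show ?case by (simp add: incidence_def)
next
  case (Suc d)
  then have "m \<noteq> 0" by auto
  then obtain e where e: "e \<in> Poly_Mapping.keys m" by (auto simp flip: keys_eq_empty)
  obtain a b k where k: "a \<noteq> b" "m = edge a b + k" "supported k"
    using Suc.prems e by (rule split_edge)
  then show ?case using Suc.hyps
    by (simp add: incidence_add incidence_edge mono_deg_add)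
qed

text \<open>
  If no other term of \<open>p\<close> had the degree and vertex parities of \<open>r\<close>, then pairing with the indicator
  function of these data would extract from the image of \<open>p\<close> the coefficient of \<open>r\<close>, which is not
  zero, although the pairing vanishes on the ideal.
\<close>

lemma cancelling_term:
  fixes p :: "('v set, 'k::comm_ring_1) mpoly"
  assumes p: "p \<in> eulerian_ideal V E" and r: "r \<in> Poly_Mapping.keys p"
  obtains m where "m \<in> Poly_Mapping.keys p" "m \<noteq> r" "m \<approx> r"
proof (rule ccontr)
  assume "\<not> thesis"
  then have no: "\<not> m \<approx> r" if "m \<in> Poly_Mapping.keys p" "m \<noteq> r" for m
    using that \<open>\<And>m. \<lbrakk>m \<in> Poly_Mapping.keys p; m \<noteq> r; m \<approx> r\<rbrakk> \<Longrightarrow> thesis\<close> by blast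
  have supp: "supported m" if "m \<in> Poly_Mapping.keys p" for m
    using p that by (auto simp: eulerian_ideal_def carrier_mpoly_ring supported_def)
  \<comment> \<open>The degree is compared after \<^const>\<open>edge_hom\<close>, which doubles it.\<close>
  define h where "h a = (if mono_deg a = mono_deg (incidence r) \<and>
      (\<forall>v. even (Poly_Mapping.lookup a v) = even (vdeg r v)) then 1 else 0 :: 'k)" for a
  have "parity_invariant h" by (simp add: parity_invariant_def h_def)
  then have "pairing (\<lambda>m. h (incidence m)) p = 0"
    using pairing_square_diff_ideal p by (auto simp: eulerian_ideal_def simp flip: pairing_edge_hom)
  moreover have "h (incidence m) = (if m = r then 1 else 0)" if "m \<in> Poly_Mapping.keys p" for m
  proof (cases "m = r")
    case False
    have "\<not> (mono_deg m = mono_deg r \<and> (\<forall>v. even (vdeg m v) = even (vdeg r v)))"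
      using no[OF that False] swap_eq_if_same_invariants supp that r by blast
    then show ?thesis using False mono_deg_incidence supp that r by (auto simp: h_def vdeg_def)
  qed (simp add: h_def vdeg_def)
  then have "pairing (\<lambda>m. h (incidence m)) p = (\<Sum>m\<in>Poly_Mapping.keys p.
      if m = r then Poly_Mapping.lookup p m else 0)"
    unfolding pairing_def by (intro sum.cong) auto
  ultimately show False using r by (simp add: in_keys_iff)
qed

text \<open>
  A term of \<open>p\<close> is absorbed into another one with the same invariants by subtracting a multiple of a
  binomial of the quadratic ideal. This lowers the number of terms and keeps \<open>p\<close> in the Eulerian
  ideal.
\<close>

lemma eulerian_ideal_subset_quadric:
  "p \<in> eulerian_ideal V E \<Longrightarrow>
    (p :: ('v set, 'k::comm_ring_1) mpoly) \<in> genideal (mpoly_ring E) (quadric_binomials V E)"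
proof (induction "card (Poly_Mapping.keys p)" arbitrary: p rule: less_induct)
  case less
  let ?J = "genideal (mpoly_ring E) (quadric_binomials V E) :: ('v set, 'k) mpoly set"
  show ?case
  proof (cases "p = 0")
    case True
    then show ?thesis using mpoly_ideal_zero[OF quadric_ideal] by simp
  next
    case False
    then obtain r where r: "r \<in> Poly_Mapping.keys p" by (auto simp flip: keys_eq_empty)
    obtain m where m: "m \<in> Poly_Mapping.keys p" "m \<noteq> r" "m \<approx> r"
      using less.prems r by (rule cancelling_term)
    define c where "c = Poly_Mapping.lookup p m"
    define b where "b = Poly_Mapping.single m c - Poly_Mapping.single r c"
    have "b = Poly_Mapping.single 0 c * (Poly_Mapping.single m 1 - Poly_Mapping.single r 1)"
      by (simp add: b_def right_diff_distrib mult_single)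
    then have b: "b \<in> ?J"
      using mpoly_ideal_mult[OF quadric_ideal swap_eq_binomial[OF m(3)] single_closed[of 0 E c]]
      by simp
    have "Poly_Mapping.keys (p - b) \<subseteq> Poly_Mapping.keys p - {m}"
      using r m by (auto simp: b_def c_def in_keys_iff lookup_minus lookup_single when_def split: if_splits)
    then have "card (Poly_Mapping.keys (p - b)) < card (Poly_Mapping.keys p)"
      using m by (intro psubset_card_mono) auto
    moreover have "p - b \<in> eulerian_ideal V E"
      using mpoly_ideal_diff[OF eulerian_ideal less.prems] b quadric_ideal_subset by blast
    ultimately have "p - b \<in> ?J" by (rule less.hyps)
    then show ?thesis using mpoly_ideal_add[OF quadric_ideal _ b] by fastforce
  qed
qed

text \<open>
  The quadratic binomials generate the ideal, so it remains to see that it is not zero: it contains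
  the difference of the squares of two edges.
\<close>

theorem max_gen_degree_eulerian_ideal:
  assumes "card E \<ge> 2"
  shows "max_gen_degree E (eulerian_ideal V E :: ('v set, 'k::comm_ring_1) mpoly set) = 2"
proof (rule max_gen_degree_eqI)
  show "finite (quadric_binomials V E :: ('v set, 'k) mpoly set)"
    by (simp add: quadric_binomials_def finite_E)
  show "quadric_binomials V E \<subseteq> carrier (mpoly_ring E :: ('v set, 'k) mpoly ring)"
    by (rule quadric_binomials_closed)
  show "genideal (mpoly_ring E) (quadric_binomials V E :: ('v set, 'k) mpoly set) = eulerian_ideal V E"
    using quadric_ideal_subset eulerian_ideal_subset_quadric by blast
  show "mono_deg m = 2"
    if "b \<in> quadric_binomials V E" "m \<in> Poly_Mapping.keys b" for b :: "('v set, 'k) mpoly" and m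
    using that
    by (auto simp: quadric_binomials_def mvar_mult_mvar in_keys_iff lookup_minus lookup_single
        when_def mono_deg_add split: if_splits)
  obtain e f where ef: "e \<in> E" "f \<in> E" "e \<noteq> f"
    using assms card_le_Suc0_iff_eq[OF finite_E] by fastforce
  have "unit_exp e + unit_exp e \<approx> unit_exp f + unit_exp f"
    using ef by (intro swap_eq_if_same_invariants) (simp_all add: supported_def keys_add_nat mono_deg_add vdeg_add)
  from subsetD[OF quadric_ideal_subset swap_eq_binomial[OF this]]
  have "Poly_Mapping.single (unit_exp e + unit_exp e) 1 -
      Poly_Mapping.single (unit_exp f + unit_exp f) (1::'k) \<in> eulerian_ideal V E" (is "?b \<in> _") .
  moreover have "Poly_Mapping.lookup (unit_exp e + unit_exp e) e \<noteq>
      Poly_Mapping.lookup (unit_exp f + unit_exp f) e"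
    using ef by (simp add: lookup_add lookup_unit_exp)
  then have "Poly_Mapping.lookup ?b (unit_exp e + unit_exp e) = 1"
    by (auto simp: lookup_minus lookup_single when_def)
  then have "?b \<noteq> 0" by auto
  ultimately show "eulerian_ideal V E \<noteq> ({0} :: ('v set, 'k) mpoly set)" by blast
qed

end

theorem theorem4p5:
  fixes n :: nat and E :: "nat set set"
  assumes "simple_graph {1..n} E"
    and "card E \<ge> 2"
    and "complete_graph {1..n} E"
  shows "max_gen_degree E (eulerian_ideal {1..n} E :: (nat set, 'k::field) mpoly set) = 2"
proof -
  interpret complete_edges "{1..n}" E by (rule complete_edges.intro) fact
  show ?thesis by (rule max_gen_degree_eulerian_ideal) fact
qed

end
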